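(* Let $F$ be a field of characteristic two and let $(A,\sigma)$ be a totally decomposable central simple $F$-algebra with orthogonal involution. Then $$D(A,\sigma)=D(\mathfrak{Pf}(A,\sigma))=\{x^2\mid 0\neq x\in S\},$$ where $S$ is any inseparable subalgebra of $(A,\sigma)$.
   Context: Involutions are of the first kind. $(A,\sigma)$ is totally decomposable if $(A,\sigma)\simeq\bigotimes_{i=1}^n(Q_i,\sigma_i)$ with $(Q_i,\sigma_i)$ quaternion $F$-algebras with involution (each $\sigma_i$ then orthogonal). $\mathrm{Alt}(A,\sigma)=\{\sigma(x)-x\mid x\in A\}$, $\mathrm{Sym}(A,\sigma)=\{x\mid\sigma(x)=x\}$, $\mathrm{Sym}(A,\sigma)^+=\{x\in\mathrm{Sym}(A,\sigma)\mid x^2\in F\}$. For $\alpha\in F$, $\sigma$ represents $\alpha$ if there is a nonzero $x\in A$ with $\sigma(x)x+\alpha\in\mathrm{Alt}(A,\sigma)$; $D(A,\sigma)$ is the set of elements of $F$ represented by $\sigma$. For a symmetric bilinear space $(V,\mathfrak b)$, $D(\mathfrak b)=\{\mathfrak b(v,v)\mid 0\ne v\in V\}$. The bilinear Pfister form $\langle\!\langle \alpha_1,\dots,\alpha_n\rangle\!\rangle$ is $\langle1,\alpha_1\rangle\otimes\cdots\otimes\langle1,\alpha_n\rangle$. The Pfister invariant $\mathfrak{Pf}(A,\sigma)$ is $\langle\!\langle\alpha_1,\dots,\alpha_n\rangle\!\rangle$ where $\alpha_i\in F^\times$ represents the discriminant class $\mathrm{disc}\,\sigma_i\in F^\times/F^{\times2}$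 for a decomposition $\bigotimes(Q_i,\sigma_i)$; its isometry class is independent of the decomposition. If $\deg_FA=2^n$, an inseparable subalgebra is a $2^n$-dimensional subalgebra $S\subseteq\mathrm{Sym}(A,\sigma)^+$ with $C_A(S)=S$, generated as an $F$-algebra by $n$ elements. *)

theory Defs
  imports Complex_Main
begin

definition is_F_algebra :: "('f::field \<Rightarrow> 'a::ring_1 \<Rightarrow> 'a) \<Rightarrow> bool" where
  "is_F_algebra smult \<longleftrightarrow> vector_space smult \<and>
     (\<forall>c x y. smult c (x * y) = smult c x * y \<and> smult c (x * y) = x * smult c y)"

definition fin_dim :: "('f::field \<Rightarrow> 'a::ring_1 \<Rightarrow> 'a) \<Rightarrow> bool" where
  "fin_dim smult \<longleftrightarrow> (\<exists>B. finite B \<and> module.span smult B = UNIV)"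

definition subalgebra :: "('f::field \<Rightarrow> 'a::ring_1 \<Rightarrow> 'a) \<Rightarrow> 'a set \<Rightarrow> bool" where
  "subalgebra smult S \<longleftrightarrow> 1 \<in> S \<and> 0 \<in> S \<and>
     (\<forall>x\<in>S. \<forall>y\<in>S. x + y \<in> S \<and> x * y \<in> S) \<and> (\<forall>c. \<forall>x\<in>S. smult c x \<in> S)"

definition ideal_in :: "'a::ring_1 set \<Rightarrow> 'a set \<Rightarrow> bool" where
  "ideal_in S I \<longleftrightarrow> I \<subseteq> S \<and> 0 \<in> I \<and> (\<forall>x\<in>I. \<forall>y\<in>I. x + y \<in> I) \<and> (\<forall>x\<in>I. - x \<in> I) \<and>
     (\<forall>x\<in>I. \<forall>s\<in>S. s * x \<in> I \<and> x * s \<in> I)"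

definition scalars :: "('f::field \<Rightarrow> 'a::ring_1 \<Rightarrow> 'a) \<Rightarrow> 'a set" where
  "scalars smult = range (\<lambda>c. smult c 1)"

definition central_simple_on :: "('f::field \<Rightarrow> 'a::ring_1 \<Rightarrow> 'a) \<Rightarrow> 'a set \<Rightarrow> bool" where
  "central_simple_on smult S \<longleftrightarrow> subalgebra smult S \<and>
     {z\<in>S. \<forall>y\<in>S. z * y = y * z} = scalars smult \<and>
     (\<forall>I. ideal_in S I \<longrightarrow> I = {0} \<or> I = S)"

definition quaternion_subalgebra :: "('f::field \<Rightarrow> 'a::ring_1 \<Rightarrow> 'a) \<Rightarrow> 'a set \<Rightarrow> bool" where
  "quaternion_subalgebra smult Q \<longleftrightarrow> central_simple_on smult Q \<and> vector_space.dim smult Q = 4"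

definition involution_first_kind :: "('f::field \<Rightarrow> 'a::ring_1 \<Rightarrow> 'a) \<Rightarrow> ('a \<Rightarrow> 'a) \<Rightarrow> bool" where
  "involution_first_kind smult \<sigma> \<longleftrightarrow>
     (\<forall>x y. \<sigma> (x + y) = \<sigma> x + \<sigma> y) \<and> (\<forall>x y. \<sigma> (x * y) = \<sigma> y * \<sigma> x) \<and>
     (\<forall>x. \<sigma> (\<sigma> x) = x) \<and> (\<forall>c x. \<sigma> (smult c x) = smult c (\<sigma> x))"

definition Alt :: "('a::ring_1 \<Rightarrow> 'a) \<Rightarrow> 'a set \<Rightarrow> 'a set" where
  "Alt \<sigma> S = {\<sigma> x - x | x. x \<in> S}"

definition Sym :: "('a::ring_1 \<Rightarrow> 'a) \<Rightarrow> 'a set \<Rightarrow> 'a set" where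
  "Sym \<sigma> S = {x \<in> S. \<sigma> x = x}"

definition Sym_plus :: "('f::field \<Rightarrow> 'a::ring_1 \<Rightarrow> 'a) \<Rightarrow> ('a \<Rightarrow> 'a) \<Rightarrow> 'a set" where
  "Sym_plus smult \<sigma> = {x \<in> Sym \<sigma> UNIV. x * x \<in> scalars smult}"

text \<open>Characteristic two: an involution of the first kind is symplectic iff
  1 \<in> Symd = Alt; orthogonal otherwise (KMRT, Prop. 2.6).\<close>
definition orthogonal_char2 :: "('a::ring_1 \<Rightarrow> 'a) \<Rightarrow> bool" where
  "orthogonal_char2 \<sigma> \<longleftrightarrow> 1 \<notin> Alt \<sigma> UNIV"

definition ord_prod :: "nat \<Rightarrow> (nat \<Rightarrow> 'a::ring_1) \<Rightarrow> 'a" where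
  "ord_prod n q = foldr (\<lambda>i acc. q i * acc) [0..<n] 1"

text \<open>(A,\<sigma>) \<cong> \<Otimes>_{i<n} (Q_i, \<sigma>|Q_i): the Q_i are \<sigma>-stable quaternion subalgebras,
  pairwise commuting, and the multiplication map \<Otimes> Q_i \<rightarrow> A is an isomorphism
  (products of elements span A and dim A = 4^n).\<close>
definition tensor_decomposition ::
  "('f::field \<Rightarrow> 'a::ring_1 \<Rightarrow> 'a) \<Rightarrow> ('a \<Rightarrow> 'a) \<Rightarrow> nat \<Rightarrow> (nat \<Rightarrow> 'a set) \<Rightarrow> bool" where
  "tensor_decomposition smult \<sigma> n Q \<longleftrightarrow>
     (\<forall>i<n. quaternion_subalgebra smult (Q i) \<and> \<sigma> ` Q i \<subseteq> Q i) \<and>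
     (\<forall>i<n. \<forall>j<n. i \<noteq> j \<longrightarrow> (\<forall>x\<in>Q i. \<forall>y\<in>Q j. x * y = y * x)) \<and>
     module.span smult {ord_prod n q | q. \<forall>i<n. q i \<in> Q i} = UNIV \<and>
     vector_space.dim smult (UNIV :: 'a set) = 4 ^ n"

definition totally_decomposable :: "('f::field \<Rightarrow> 'a::ring_1 \<Rightarrow> 'a) \<Rightarrow> ('a \<Rightarrow> 'a) \<Rightarrow> bool" where
  "totally_decomposable smult \<sigma> \<longleftrightarrow> (\<exists>n Q. tensor_decomposition smult \<sigma> n Q)"

text \<open>Reduced norm of an element of a quaternion algebra: for a central element
  c\<cdot>1 it is c^2; otherwise the constant term of the (reduced) characteristic
  polynomial X^2 - Trd(x) X + Nrd(x) of x.\<close>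
definition quat_nrd :: "('f::field \<Rightarrow> 'a::ring_1 \<Rightarrow> 'a) \<Rightarrow> 'a \<Rightarrow> 'f" where
  "quat_nrd smult x =
     (if x \<in> scalars smult then (THE c. x = smult c 1) ^ 2
      else (THE c. \<exists>t. x * x - smult t x + smult c 1 = 0))"

text \<open>\<alpha> represents disc(\<sigma>|Q) in F^\<times>/F^\<times>2 (KMRT 7.2: disc \<sigma> = (-1)^{deg/2} Nrd(a)
  for an invertible a \<in> Alt(Q,\<sigma>|Q)).\<close>
definition represents_disc :: "('f::field \<Rightarrow> 'a::ring_1 \<Rightarrow> 'a) \<Rightarrow> ('a \<Rightarrow> 'a) \<Rightarrow> 'a set \<Rightarrow> 'f \<Rightarrow> bool" where
  "represents_disc smult \<sigma> Q \<alpha> \<longleftrightarrow> \<alpha> \<noteq> 0 \<and>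
     (\<exists>a\<in>Alt \<sigma> Q. (\<exists>b\<in>Q. a * b = 1 \<and> b * a = 1) \<and>
        (\<exists>e. e \<noteq> 0 \<and> \<alpha> = - quat_nrd smult a * e ^ 2))"

text \<open>Values represented by the bilinear Pfister form <<\<alpha>_0,...,\<alpha>_(n-1)>>, which is
  the diagonal form with entries \<Prod>_{i\<in>I} \<alpha>_i, I \<subseteq> {0..<n}.\<close>
definition D_pfister :: "nat \<Rightarrow> (nat \<Rightarrow> 'f::field) \<Rightarrow> 'f set" where
  "D_pfister n \<alpha> = {(\<Sum>I\<in>Pow {..<n}. (\<Prod>i\<in>I. \<alpha> i) * v I ^ 2) | v.
       \<exists>I\<in>Pow {..<n}. v I \<noteq> 0}"

definition D_inv :: "('f::field \<Rightarrow> 'a::ring_1 \<Rightarrow> 'a) \<Rightarrow> ('a \<Rightarrow> 'a) \<Rightarrow> 'f set" where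
  "D_inv smult \<sigma> = {\<alpha>. \<exists>x. x \<noteq> 0 \<and> \<sigma> x * x + smult \<alpha> 1 \<in> Alt \<sigma> UNIV}"

definition gen_subalgebra :: "('f::field \<Rightarrow> 'a::ring_1 \<Rightarrow> 'a) \<Rightarrow> 'a set \<Rightarrow> 'a set" where
  "gen_subalgebra smult X = \<Inter> {S. subalgebra smult S \<and> X \<subseteq> S}"

definition centralizer :: "'a::ring_1 set \<Rightarrow> 'a set" where
  "centralizer S = {x. \<forall>s\<in>S. x * s = s * x}"

definition inseparable_subalgebra ::
  "('f::field \<Rightarrow> 'a::ring_1 \<Rightarrow> 'a) \<Rightarrow> ('a \<Rightarrow> 'a) \<Rightarrow> 'a set \<Rightarrow> bool" where
  "inseparable_subalgebra smult \<sigma> S \<longleftrightarrow>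
     (\<exists>m. vector_space.dim smult (UNIV :: 'a set) = 4 ^ m \<and>
        subalgebra smult S \<and> vector_space.dim smult S = 2 ^ m \<and>
        S \<subseteq> Sym_plus smult \<sigma> \<and> centralizer S = S \<and>
        (\<exists>g. length g = m \<and> gen_subalgebra smult (set g) = S))"

end

theory Submission
  imports Defs
begin

text \<open>Let \<open>S\<close> be generated by commuting symmetric square-central \<open>g\<^sub>i\<close>, with \<open>C\<^sub>A(S) = S\<close>, and let
  \<open>D\<^sub>i = [g\<^sub>i, _]\<close>. In characteristic two the \<open>D\<^sub>i\<close> are commuting derivations of square zero that
  commute with \<open>\<sigma>\<close>, and a dimension count yields \<open>u\<^sub>j\<close> with \<open>D\<^sub>i u\<^sub>j = \<delta>\<^sub>i\<^sub>j\<close>. The product \<open>\<Theta>\<close> of all \<open>D\<^sub>i\<close>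
  is an \<open>S\<close>-bimodule map \<open>A \<rightarrow> S\<close> that kills \<open>Alt(A,\<sigma>)\<close>; over \<open>S\<close>, the form \<open>\<Theta>(\<sigma>(x) y)\<close> plays the role
  of the symmetric bilinear form to which \<open>\<sigma>\<close> is adjoint. The map \<open>q(z) = \<Theta>(\<sigma>(z) z)\<close> is additive, which
  forces \<open>q(z) = \<Theta>(z)\<^sup>2 T\<close> for a constant \<open>T \<in> S\<close>, and \<open>T \<noteq> 0\<close> because \<open>q = 0\<close> would put 1 into
  \<open>Alt(A,\<sigma>)\<close>. If \<open>\<sigma>(x) x + \<alpha> \<in> Alt(A,\<sigma>)\<close>, then \<open>q(x y) = \<alpha> q(y)\<close> for all \<open>y\<close>; comparing the two
  formulas exhibits \<open>\<alpha>\<close> as the square of an element \<open>\<Theta>(x y) \<noteq> 0\<close> of \<open>S\<close>. This applies to any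
  inseparable subalgebra, and also to the algebra generated by elements \<open>v\<^sub>i \<in> Alt(Q\<^sub>i,\<sigma>\<^sub>i)\<close> with
  \<open>v\<^sub>i\<^sup>2 = \<alpha>\<^sub>i\<close>, whose squares are the values of the Pfister form.\<close>

section \<open>Rank and nullity\<close>

text \<open>A linear right inverse of \<open>f\<close> embeds the image of \<open>V\<close> back
  into \<open>V\<close> as a complement of the kernel.\<close>

lemma (in finite_dimensional_vector_space) rank_nullity:
  assumes f: "Vector_Spaces.linear scale scale f" and V: "subspace V"
  shows "dim (f ` V) + dim {x \<in> V. f x = 0} = dim V"
proof -
  interpret p: finite_dimensional_vector_space_pair scale Basis scale Basis ..
  interpret f: Vector_Spaces.linear scale scale f by (fact f)
  obtain g where gr: "range g \<subseteq> V" and g: "Vector_Spaces.linear scale scale g"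
    and fg: "\<forall>x\<in>f ` V. f (g x) = x"
    using p.linear_exists_right_inverse_on[OF f V] by auto
  interpret g: Vector_Spaces.linear scale scale g by (fact g)
  let ?K = "{x \<in> V. f x = 0}" and ?W = "g ` f ` V"
  have sub: "subspace ?K" "subspace ?W"
    using V f.subspace_image[OF V] g.subspace_image
    by (auto simp: subspace_def f.add f.scale)
  have "{x + y |x y. x \<in> ?K \<and> y \<in> ?W} = V"
  proof (intro equalityI subsetI)
    fix z assume z: "z \<in> V"
    have "z - g (f z) \<in> ?K"
      using z gr fg V by (auto simp: f.diff intro: subspace_diff)
    moreover have "z = (z - g (f z)) + g (f z)" by simp
    ultimately show "z \<in> {x + y |x y. x \<in> ?K \<and> y \<in> ?W}" using z by blast
  qed (use gr V in \<open>auto intro!: subspace_add\<close>)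
  moreover have "?K \<inter> ?W = {0}"
    using fg sub(1)[THEN subspace_0] sub(2)[THEN subspace_0] by auto 
  moreover have "dim ?W = dim (f ` V)"
  proof (rule p.dim_image_eq[OF g])
    show "inj_on g (span (f ` V))"
      using fg f.subspace_image[OF V] by (metis inj_onI span_eq_iff)
  qed
  ultimately show ?thesis using dim_sums_Int[OF sub] by simp
qed

section \<open>Commuting inner derivations and the values of an involution\<close>

locale char2_algebra_involution = vector_space smult
  for smult :: "'f::field \<Rightarrow> 'a::ring_1 \<Rightarrow> 'a" +
  fixes \<sigma> :: "'a \<Rightarrow> 'a"
  assumes char2: "CHAR('f) = 2"
    and mult_smult_left: "smult c x * y = smult c (x * y)"
    and mult_smult_right: "x * smult c y = smult c (x * y)"
    and inv: "involution_first_kind smult \<sigma>"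
begin

lemma field_double [simp]: "(c::'f) + c = 0"
proof -
  have "(2::'f) = 0" using of_nat_CHAR[where 'a='f] char2 by simp
  then show ?thesis by (metis mult_2 mult_zero_left)
qed

lemma double [simp]: "(x::'a) + x = 0"
  by (metis field_double scale_left_distrib scale_one scale_zero_left)

lemma double_left [simp]: "(x::'a) + (x + y) = y"
  by (simp flip: add.assoc)

lemma add_eq_0_iff_eq: "(x::'a) + y = 0 \<longleftrightarrow> x = y"
  by (metis add_left_cancel double)

lemma minus_eq [simp]: "- (x::'a) = x"
  by (simp add: minus_unique)

lemma diff_eq_add [simp]: "(x::'a) - y = x + y"
  using diff_conv_add_uminus[of x y] by simp

lemma inv_add [simp]: "\<sigma> (x + y) = \<sigma> x + \<sigma> y"
  and inv_mult [simp]: "\<sigma> (x * y) = \<sigma> y * \<sigma> x"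
  and inv_inv [simp]: "\<sigma> (\<sigma> x) = x"
  and inv_smult [simp]: "\<sigma> (smult c x) = smult c (\<sigma> x)"
  using inv by (auto simp: involution_first_kind_def)

lemma inv_0 [simp]: "\<sigma> 0 = 0"
  using inv_add[of 0 0] by (metis double)

lemma inv_1 [simp]: "\<sigma> 1 = 1"
  by (metis inv_inv inv_mult mult.left_neutral mult.right_neutral)

lemma smult_1_mult: "smult c 1 * x = smult c x" "x * smult c 1 = smult c x"
  by (simp_all add: mult_smult_left mult_smult_right)

lemma scalar_mult_self: "smult c x * smult c x = smult (c ^ 2) (x * x)"
  by (simp add: mult_smult_left mult_smult_right power2_eq_square)

lemma Alt_iff: "a \<in> Alt \<sigma> S \<longleftrightarrow> (\<exists>x\<in>S. a = x + \<sigma> x)"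
  by (auto simp: Alt_def add.commute)

lemma AltI: "x \<in> S \<Longrightarrow> x + \<sigma> x \<in> Alt \<sigma> S"
  by (auto simp: Alt_iff)

lemma Alt_inv: "a \<in> Alt \<sigma> S \<Longrightarrow> \<sigma> a = a"
  by (auto simp: Alt_iff add.commute)

lemma linear_commutator: "Vector_Spaces.linear smult smult (\<lambda>x. a * x + x * a)"
  by unfold_locales
    (simp_all add: algebra_simps scale_right_distrib mult_smult_left mult_smult_right)

lemma linear_one_plus_inv: "Vector_Spaces.linear smult smult (\<lambda>x. x + \<sigma> x)"
  by unfold_locales (simp_all add: algebra_simps scale_right_distrib)

end

text \<open>\<open>C_inv\<close> and \<open>C_square\<close> say that the common centralizer of the
  \<open>g i\<close> lies in \<open>Sym_plus\<close>; as the \<open>g i\<close> commute, they lie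
  there too. Both inseparable subalgebras and tensor decompositions will supply such data.\<close>

locale dual_system = char2_algebra_involution smult \<sigma>
  for smult :: "'f::field \<Rightarrow> 'a::ring_1 \<Rightarrow> 'a" and \<sigma> +
  fixes n :: nat and g u :: "nat \<Rightarrow> 'a"
  assumes g_comm: "i < n \<Longrightarrow> j < n \<Longrightarrow> g i * g j = g j * g i"
    and C_inv: "(\<And>i. i < n \<Longrightarrow> g i * s = s * g i) \<Longrightarrow> \<sigma> s = s"
    and C_square: "(\<And>i. i < n \<Longrightarrow> g i * s = s * g i) \<Longrightarrow> s * s \<in> scalars smult"
    and dual: "i < n \<Longrightarrow> j < n \<Longrightarrow> g i * u j + u j * g i = of_bool (i = j)"
begin

lemma g_inv: "i < n \<Longrightarrow> \<sigma> (g i) = g i"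
  by (rule C_inv) (rule g_comm)

lemma g_square: "i < n \<Longrightarrow> g i * g i \<in> scalars smult"
  by (rule C_square) (rule g_comm)

section \<open>Derivations of square zero and their product\<close>

definition D :: "nat \<Rightarrow> 'a \<Rightarrow> 'a" where
  "D i x = g i * x + x * g i"

text \<open>The truncated products are kept because nondegeneracy, the evaluation of
  \<open>q\<close> and the descent to \<open>Alt\<close> treat one derivation at a time.\<close>

fun \<Theta> :: "nat \<Rightarrow> 'a \<Rightarrow> 'a" where
  "\<Theta> 0 x = x"
| "\<Theta> (Suc k) x = D k (\<Theta> k x)"

lemma D_add [simp]: "D i (x + y) = D i x + D i y"
  by (simp add: D_def algebra_simps)

lemma D_0 [simp]: "D i 0 = 0"
  by (simp add: D_def)

lemma D_1 [simp]: "D i 1 = 0"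
  by (simp add: D_def)

lemma D_mult: "D i (x * y) = D i x * y + x * D i y"
  by (simp add: D_def algebra_simps)

lemma D_inv: "i < n \<Longrightarrow> D i (\<sigma> x) = \<sigma> (D i x)"
  by (simp add: D_def g_inv algebra_simps)

lemma D_dual: "i < n \<Longrightarrow> j < n \<Longrightarrow> D i (u j) = of_bool (i = j)"
  by (simp add: D_def dual)

lemma D_eq_0_iff: "D i x = 0 \<longleftrightarrow> g i * x = x * g i"
  by (simp add: D_def add_eq_0_iff_eq)

lemma D_comm: "i < n \<Longrightarrow> j < n \<Longrightarrow> D i (D j x) = D j (D i x)"
  using g_comm[of i j] by (simp add: D_def distrib_left distrib_right add_ac mult.assoc)
    (metis mult.assoc)

lemma scalars_comm: "a \<in> scalars smult \<Longrightarrow> a * x = x * a"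
  by (auto simp: scalars_def smult_1_mult)

text \<open>In characteristic two \<open>D i\<close> applied twice is the commutator with
  \<open>g i * g i\<close>, which is central.\<close>

lemma D_D [simp]: "i < n \<Longrightarrow> D i (D i x) = 0"
  using scalars_comm[OF g_square, of i x]
  by (simp add: D_def distrib_left distrib_right add_ac mult.assoc)

lemma Theta_add [simp]: "\<Theta> k (x + y) = \<Theta> k x + \<Theta> k y"
  by (induction k) auto

lemma Theta_0 [simp]: "\<Theta> k 0 = 0"
  by (induction k) auto

lemma Theta_inv: "k \<le> n \<Longrightarrow> \<Theta> k (\<sigma> x) = \<sigma> (\<Theta> k x)"
  by (induction k) (auto simp: D_inv)

lemma D_Theta: "j < n \<Longrightarrow> k \<le> n \<Longrightarrow> D j (\<Theta> k x) = \<Theta> k (D j x)"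
  by (induction k) (auto simp: D_comm)

lemma D_Theta_eq_0: "j < k \<Longrightarrow> k \<le> n \<Longrightarrow> D j (\<Theta> k x) = 0"
proof (induction k)
  case (Suc k)
  show ?case
  proof (cases "j = k")
    case False
    then show ?thesis using Suc D_comm[of j k "\<Theta> k x"] by auto
  qed (use Suc in auto)
qed simp

text \<open>The factor \<open>D j\<close> of \<open>\<Theta> k\<close> commutes with the others, so
  it may act first, directly on \<open>x\<close>.\<close>

lemma Theta_eq_0: "D j x = 0 \<Longrightarrow> j < k \<Longrightarrow> k \<le> n \<Longrightarrow> \<Theta> k x = 0"
proof (induction k)
  case (Suc k)
  show ?case
  proof (cases "j = k")
    case True
    then show ?thesis using Suc by (simp add: D_Theta)
  qed (use Suc in auto)
qed simp

lemma Theta_mult_left: "(\<And>i. i < k \<Longrightarrow> D i a = 0) \<Longrightarrow> \<Theta> k (a * x) = a * \<Theta> k x"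
  by (induction k) (auto simp: D_mult)

lemma Theta_mult_right: "(\<And>i. i < k \<Longrightarrow> D i a = 0) \<Longrightarrow> \<Theta> k (x * a) = \<Theta> k x * a"
  by (induction k) (auto simp: D_mult)

text \<open>If \<open>y\<close> works for \<open>k\<close> but \<open>D k\<close> kills
  \<open>\<Theta> k (x * y)\<close>, then \<open>y * u k\<close> works for \<open>Suc k\<close>: the
  factor \<open>u k\<close> comes out of \<open>\<Theta> k\<close>, and \<open>D k\<close> sends it
  to 1.\<close>

lemma Theta_nondegenerate:
  assumes "x \<noteq> 0" "k \<le> n"
  shows "\<exists>y. \<Theta> k (x * y) \<noteq> 0"
  using assms(2)
proof (induction k)
  case 0
  then show ?case using assms(1) by (auto intro: exI[of _ 1])
next
  case (Suc k)
  then obtain y where y: "\<Theta> k (x * y) \<noteq> 0" by auto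
  show ?case
  proof (cases "D k (\<Theta> k (x * y)) = 0")
    case True
    have "\<Theta> k (x * y * u k) = \<Theta> k (x * y) * u k"
      using Suc.prems by (intro Theta_mult_right) (auto simp: D_dual)
    then have "\<Theta> (Suc k) (x * (y * u k)) = \<Theta> k (x * y)"
      using True Suc.prems by (simp add: D_mult D_dual mult.assoc)
    then show ?thesis using y by metis
  qed auto
qed

text \<open>The centralizer of the first \<open>k\<close> elements \<open>g i\<close>: the whole
  algebra for \<open>k = 0\<close>, the algebra S of the overview for \<open>k = n\<close>.\<close>

definition C :: "nat \<Rightarrow> 'a set" where
  "C k = {z. \<forall>i<k. D i z = 0}"

lemma C_n_iff: "s \<in> C n \<longleftrightarrow> (\<forall>i<n. g i * s = s * g i)"
  by (simp add: C_def D_eq_0_iff)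

lemma C_n_inv: "s \<in> C n \<Longrightarrow> \<sigma> s = s"
  using C_inv C_n_iff by blast

lemma C_n_square: "s \<in> C n \<Longrightarrow> s * s \<in> scalars smult"
  using C_square C_n_iff by blast

lemma C_add: "x \<in> C k \<Longrightarrow> y \<in> C k \<Longrightarrow> x + y \<in> C k"
  by (simp add: C_def)

lemma C_mult: "x \<in> C k \<Longrightarrow> y \<in> C k \<Longrightarrow> x * y \<in> C k"
  by (simp add: C_def D_mult)

lemma C_inv_closed: "x \<in> C k \<Longrightarrow> k \<le> n \<Longrightarrow> \<sigma> x \<in> C k"
  by (simp add: C_def D_inv)

lemma C_Suc: "x \<in> C (Suc k) \<longleftrightarrow> x \<in> C k \<and> D k x = 0"
  by (auto simp: C_def less_Suc_eq)

lemma D_in_C_Suc: "x \<in> C k \<Longrightarrow> k < n \<Longrightarrow> D k x \<in> C (Suc k)"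
  by (auto simp: C_Suc) (auto simp: C_def D_comm[of _ k])

lemma g_in_C: "k < n \<Longrightarrow> g k \<in> C k"
  by (auto simp: C_def D_eq_0_iff g_comm)

lemma u_in_C: "k < n \<Longrightarrow> u k \<in> C k"
  by (auto simp: C_def D_dual)

lemma one_in_C: "1 \<in> C k"
  by (simp add: C_def)

lemma Theta_in_C: "k \<le> n \<Longrightarrow> \<Theta> k x \<in> C k"
  by (simp add: C_def D_Theta_eq_0)

lemma Theta_smult: "\<Theta> k (smult c x) = smult c (\<Theta> k x)"
  by (induction k) (simp_all add: D_def mult_smult_left mult_smult_right scale_right_distrib)

text \<open>\<open>\<Theta> n\<close> commutes with \<sigma> and has symmetric values, so the two
  terms have the same image and cancel.\<close>

lemma Theta_add_inv: "\<Theta> n (x + \<sigma> x) = 0"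
  by (simp add: Theta_inv C_n_inv[OF Theta_in_C])

section \<open>The additive map \<open>q\<close> and its evaluation\<close>

definition q :: "'a \<Rightarrow> 'a" where
  "q z = \<Theta> n (\<sigma> z * z)"

text \<open>Modulo sums of elements each killed by some \<open>D i\<close>, every \<open>z\<close>
  equals \<open>\<Theta> n z * w n\<close>; hence \<open>q (w n)\<close> determines
  \<open>q\<close>.\<close>

fun w :: "nat \<Rightarrow> 'a" where
  "w 0 = 1"
| "w (Suc k) = u k * w k"

lemma D_w: "k \<le> i \<Longrightarrow> i < n \<Longrightarrow> D i (w k) = 0"
  by (induction k) (auto simp: D_mult D_dual)

text \<open>The cross terms form an alternating element, which \<open>\<Theta> n\<close>
  kills.\<close>

lemma q_add: "q (x + y) = q x + q y"
proof -
  have "\<sigma> (x + y) * (x + y) = \<sigma> x * x + \<sigma> y * y + (\<sigma> x * y + \<sigma> (\<sigma> x * y))"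
    by (simp add: algebra_simps)
  then show ?thesis
    unfolding q_def by (simp only: Theta_add Theta_add_inv[unfolded Theta_add] add_0_right)
qed

lemma q_eq_0: "i < n \<Longrightarrow> D i z = 0 \<Longrightarrow> q z = 0"
  unfolding q_def by (rule Theta_eq_0[of i]) (auto simp: D_mult D_inv)

lemma q_Theta_w: "k \<le> n \<Longrightarrow> q z = q (\<Theta> k z * w k)"
proof (induction k)
  case (Suc k)
  let ?z = "\<Theta> k z"
  \<comment> \<open>Since \<open>D k (u k) = 1\<close> and \<open>D k\<close> squares to zero,
    \<open>D k\<close> kills \<open>?r\<close>; this is the part of \<open>?z\<close> invisible to
    \<open>q\<close>.\<close>
  let ?r = "?z + D k ?z * u k"
  have "D k (?r * w k) = 0"
    using Suc.prems by (simp add: D_mult D_dual D_w)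
  then have "q (?r * w k) = 0"
    using Suc.prems by (intro q_eq_0[of k]) auto
  moreover have "?z * w k = ?r * w k + \<Theta> (Suc k) z * w (Suc k)"
    by (simp add: distrib_right mult.assoc add.assoc)
  ultimately show ?case
    using Suc by (simp add: q_add)
qed simp

text \<open>The element \<open>\<Theta> n z\<close> is symmetric with scalar square, so this square
  comes out of \<open>q (\<Theta> n z * w n)\<close>.\<close>

lemma q_eq: "q z = \<Theta> n z * \<Theta> n z * q (w n)"
proof -
  let ?s = "\<Theta> n z"
  obtain c where c: "?s * ?s = smult c 1"
    using C_n_square[OF Theta_in_C] by (auto simp: scalars_def)
  have "\<sigma> (?s * w n) * (?s * w n) = \<sigma> (w n) * (?s * ?s) * w n"
    by (simp add: C_n_inv[OF Theta_in_C] mult.assoc)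
  also have "\<dots> = smult c (\<sigma> (w n) * w n)"
    by (simp add: c mult_smult_left mult_smult_right)
  finally have "q (?s * w n) = smult c (q (w n))"
    by (simp add: q_def Theta_smult)
  then show ?thesis
    using q_Theta_w[of n z] by (simp add: c smult_1_mult)
qed

text \<open>After removing an alternating element, \<open>y\<close> commutes with \<open>g\<^sub>k\<close>; testing with \<open>z = u\<^sub>k\<close> then gives a
  symmetric \<open>f\<close> with \<open>D\<^sub>k f = y\<close>, and \<open>g\<^sub>k f + f g\<^sub>k\<close> is alternating.\<close>

lemma Alt_step:
  assumes k: "k < n" and y: "y \<in> C k" "\<sigma> y = y"
    and alt: "\<And>z. z \<in> C k \<Longrightarrow> D k (\<sigma> z * y * z) \<in> Alt \<sigma> (C (Suc k))"
  shows "y \<in> Alt \<sigma> (C k)"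
proof -
  note [simp] = D_mult D_inv[OF k] D_dual[OF k k]
  obtain c where c: "c \<in> C (Suc k)" "D k y = c + \<sigma> c"
    using alt[OF one_in_C] by (auto simp: Alt_iff)
  \<comment> \<open>Multiplication by \<open>u k\<close> integrates \<open>c\<close>:
    \<open>D k a = c\<close>, so adding \<open>a + \<sigma> a\<close> to \<open>y\<close> cancels
    \<open>D k y\<close>.\<close>
  define a where "a = u k * c"
  have a: "a \<in> C k" "D k a = c"
    using c u_in_C[OF k] by (auto simp: a_def C_mult C_Suc)
  define y' where "y' = y + (a + \<sigma> a)"
  have y': "y' \<in> C k" "D k y' = 0" "\<sigma> y' = y'"
    using a y c k by (auto simp: y'_def C_add C_inv_closed add_ac)
  let ?b = "\<sigma> (u k) * a * u k"
  have b: "D k ?b \<in> C (Suc k)"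
    using a k by (intro D_in_C_Suc C_mult C_inv_closed u_in_C) auto
  obtain d where d: "d \<in> C (Suc k)" "D k (\<sigma> (u k) * y * u k) = d + \<sigma> d"
    using alt[OF u_in_C[OF k]] by (auto simp: Alt_iff)
  \<comment> \<open>Passing from \<open>y\<close> to \<open>y'\<close> changes the test at
    \<open>u k\<close> by an alternating element, whose preimage \<open>D k ?b\<close> is absorbed
    here.\<close>
  define e where "e = d + D k ?b"
  have e: "e \<in> C (Suc k)" using b d by (simp add: e_def C_add)
  have "\<sigma> (u k) * y' * u k = \<sigma> (u k) * y * u k + (?b + \<sigma> ?b)"
    by (simp add: y'_def algebra_simps)
  then have "D k (\<sigma> (u k) * y' * u k) = (d + \<sigma> d) + (D k ?b + \<sigma> (D k ?b))"
    using d(2) by (simp only: D_add D_inv[OF k])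
  also have "\<dots> = e + \<sigma> e"
    by (simp add: e_def add_ac)
  finally have e': "y' * u k + \<sigma> (u k) * y' = e + \<sigma> e"
    using y' by simp
  \<comment> \<open>By \<open>e'\<close>, the failure of \<open>y' * u k\<close> to be symmetric is
    exactly \<open>e + \<sigma> e\<close>, so adding \<open>e\<close> repairs it.\<close>
  define f where "f = y' * u k + e"
  have "\<sigma> f = f"
    using e' y' unfolding f_def
    by (simp add: add.commute) (metis add.assoc add.commute double_left)
  moreover have "D k f = y'"
    using e y' by (simp add: f_def C_Suc)
  ultimately have "y' = g k * f + \<sigma> (g k * f)"
    using k by (simp add: D_def g_inv)
  then have "y = (g k * f + a) + \<sigma> (g k * f + a)"
    unfolding y'_def by (simp add: add_ac) (metis add.assoc add.commute double_left)
  moreover have "g k * f + a \<in> C k"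
    using e y' a g_in_C[OF k] u_in_C[OF k] by (simp add: f_def C_add C_mult C_Suc)
  ultimately show ?thesis by (metis AltI)
qed

text \<open>Downward induction on \<open>k\<close>: at \<open>k = n\<close> the values vanish by
  assumption, \<open>Alt_step\<close> removes one derivation at a time, and \<open>k = 0\<close>
  with \<open>z = 1\<close> gives the claim.\<close>

lemma one_in_Alt_if_q_eq_0:
  assumes "\<And>z. q z = 0"
  shows "1 \<in> Alt \<sigma> UNIV"
proof -
  have "\<forall>z. \<Theta> 0 (\<sigma> z * z) \<in> Alt \<sigma> (C 0)"
  proof (rule inc_induct[of 0 n])
    show "\<forall>z. \<Theta> n (\<sigma> z * z) \<in> Alt \<sigma> (C n)"
      using assms by (auto simp: q_def[symmetric] Alt_iff C_def intro!: exI[of _ 0])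
  next
    fix k assume k: "k < n" and IH: "\<forall>z. \<Theta> (Suc k) (\<sigma> z * z) \<in> Alt \<sigma> (C (Suc k))"
    show "\<forall>z. \<Theta> k (\<sigma> z * z) \<in> Alt \<sigma> (C k)"
    proof
      fix z
      show "\<Theta> k (\<sigma> z * z) \<in> Alt \<sigma> (C k)"
      proof (rule Alt_step[OF k])
        show "\<Theta> k (\<sigma> z * z) \<in> C k"
          using k by (simp add: Theta_in_C)
        show "\<sigma> (\<Theta> k (\<sigma> z * z)) = \<Theta> k (\<sigma> z * z)"
          using k by (simp flip: Theta_inv)
        \<comment> \<open>Elements of \<open>C k\<close> pass through \<open>\<Theta> k\<close>, so
          the test element merges with \<open>z\<close> into \<open>z * z'\<close>. This is why the
          induction ranges over all \<open>z\<close>.\<close>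
        fix z' assume z': "z' \<in> C k"
        then have "\<sigma> z' \<in> C k" using k by (simp add: C_inv_closed)
        with z' have "\<sigma> z' * \<Theta> k (\<sigma> z * z) * z' = \<Theta> k (\<sigma> z' * (\<sigma> z * z) * z')"
          by (simp add: Theta_mult_left Theta_mult_right C_def)
        also have "\<dots> = \<Theta> k (\<sigma> (z * z') * (z * z'))"
          by (simp add: mult.assoc)
        finally have eq: "\<sigma> z' * \<Theta> k (\<sigma> z * z) * z' = \<Theta> k (\<sigma> (z * z') * (z * z'))" .
        show "D k (\<sigma> z' * \<Theta> k (\<sigma> z * z) * z') \<in> Alt \<sigma> (C (Suc k))"
          using IH[rule_format, of "z * z'"] by (simp only: \<Theta>.simps eq)
      qed
    qed
  qed simp
  then have "\<Theta> 0 (\<sigma> 1 * 1) \<in> Alt \<sigma> (C 0)" by blast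
  then show ?thesis by (auto simp: Alt_iff)
qed

theorem D_inv_eq_squares:
  assumes orth: "orthogonal_char2 \<sigma>"
  shows "D_inv smult \<sigma> = {c. \<exists>s\<in>C n. s \<noteq> 0 \<and> s * s = smult c 1}"
proof (intro equalityI subsetI)
  fix \<alpha> assume "\<alpha> \<in> D_inv smult \<sigma>"
  then obtain x a where x: "x \<noteq> 0" and "\<sigma> x * x + smult \<alpha> 1 = a + \<sigma> a"
    by (auto simp: D_inv_def Alt_iff)
  then have xx: "\<sigma> x * x = smult \<alpha> 1 + (a + \<sigma> a)"
    by (metis add.commute double_left)
  define T where "T = q (w n)"
  have "T \<noteq> 0"
    using one_in_Alt_if_q_eq_0 q_eq orth unfolding T_def orthogonal_char2_def
    by (metis mult_zero_right)
  have qx: "q (x * y) = smult \<alpha> (q y)" for y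
  proof -
    have "\<sigma> (x * y) * (x * y) = \<sigma> y * (\<sigma> x * x) * y"
      by (simp add: mult.assoc)
    also have "\<dots> = smult \<alpha> (\<sigma> y * y) + (\<sigma> y * a * y + \<sigma> (\<sigma> y * a * y))"
      by (simp add: xx algebra_simps mult_smult_left mult_smult_right)
    finally show ?thesis
      by (simp only: q_def Theta_add Theta_smult Theta_add_inv[unfolded Theta_add] add_0_right)
  qed
  have sq: "\<exists>c. s * s = smult c 1 \<and> s * s * T = smult c T" if "s \<in> C n" for s
    using C_n_square[OF that] by (auto simp: scalars_def smult_1_mult)
  \<comment> \<open>The square is a scalar, so it can be compared with \<alpha> by cancelling the
    nonzero vector \<open>T\<close>, even if \<open>T\<close> is not invertible.\<close>
  have key: "\<Theta> n z * \<Theta> n z = smult \<alpha> 1" if "smult \<alpha> T = q z" for z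
    using sq[OF Theta_in_C[of n z]] that q_eq[of z] \<open>T \<noteq> 0\<close> by (auto simp: T_def)
  show "\<alpha> \<in> {c. \<exists>s\<in>C n. s \<noteq> 0 \<and> s * s = smult c 1}"
  \<comment> \<open>For \<alpha> = 0 the square does not show that the root is nonzero, so
    nondegeneracy chooses the test element; otherwise \<open>w n\<close> serves.\<close>
  proof (cases "\<alpha> = 0")
    case True
    obtain y where "\<Theta> n (x * y) \<noteq> 0"
      using Theta_nondegenerate[OF x] by blast
    moreover have "\<Theta> n (x * y) * \<Theta> n (x * y) = smult \<alpha> 1"
      using key[of "x * y"] qx[of y] True by simp
    ultimately show ?thesis using Theta_in_C by blast
  next
    case False
    have "\<Theta> n (x * w n) * \<Theta> n (x * w n) = smult \<alpha> 1"
      using key[of "x * w n"] qx[of "w n"] by (simp add: T_def)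
    moreover have "(1::'a) \<noteq> 0"
      using x by (metis mult_1_left mult_zero_left)
    ultimately have "\<Theta> n (x * w n) \<noteq> 0" 
      using False by (metis mult_zero_left scale_eq_0_iff)
    with \<open>\<Theta> n (x * w n) * \<Theta> n (x * w n) = smult \<alpha> 1\<close> show ?thesis using Theta_in_C by blast
  qed
next
  fix \<alpha> assume "\<alpha> \<in> {c. \<exists>s\<in>C n. s \<noteq> 0 \<and> s * s = smult c 1}"
  then obtain s where "s \<in> C n" "s \<noteq> 0" "s * s = smult \<alpha> 1" by blast
  \<comment> \<open>Take \<open>x = s\<close>: as \<open>s\<close> is symmetric,
    \<open>\<sigma> s * s\<close> plus the scalar \<alpha> is 0, which is alternating.\<close>
  then show "\<alpha> \<in> D_inv smult \<sigma>"
    using AltI[of 0 UNIV] by (auto simp: D_inv_def C_n_inv intro!: exI[of _ s])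
qed

end

section \<open>Inseparable subalgebras\<close>

locale fin_dim_involution =
  char2_algebra_involution smult \<sigma> + finite_dimensional_vector_space smult Basis
  for smult :: "'f::field \<Rightarrow> 'a::ring_1 \<Rightarrow> 'a" and \<sigma> Basis
begin

lemma subalgebra_subspace: "subalgebra smult S \<Longrightarrow> subspace S"
  by (simp add: subalgebra_def subspace_def)

text \<open>The product is again symmetric, while \<sigma> reverses its factors.\<close>

lemma Sym_plus_commute:
  assumes "subalgebra smult S" "S \<subseteq> Sym_plus smult \<sigma>" "x \<in> S" "y \<in> S"
  shows "x * y = y * x"
proof -
  have "x * y \<in> S" using assms by (simp add: subalgebra_def)
  then have "\<sigma> (x * y) = x * y" "\<sigma> x = x" "\<sigma> y = y"
    using assms by (auto simp: Sym_plus_def Sym_def)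
  then show ?thesis by simp
qed

lemma subspace_commuting: "subspace {x. \<forall>i\<in>I. g i * x = x * g i}"
  by (auto simp: subspace_def algebra_simps mult_smult_left mult_smult_right)

section \<open>Dimension count for commuting square-central elements\<close>

context
  fixes g :: "nat \<Rightarrow> 'a" and m :: nat
  assumes comm: "\<And>i j. i < m \<Longrightarrow> j < m \<Longrightarrow> g i * g j = g j * g i"
    and square: "\<And>i. i < m \<Longrightarrow> g i * g i \<in> scalars smult"
begin

lemma commutator_in_commuting:
  assumes "I \<subseteq> {..<m}" "k < m" "\<forall>i\<in>I. g i * x = x * g i" "j \<in> insert k I"
  shows "g j * (g k * x + x * g k) = (g k * x + x * g k) * g j"
proof (cases "j = k")
  case True
  have "g k * g k * x = x * (g k * g k)"
    using square[OF \<open>k < m\<close>] by (auto simp: scalars_def smult_1_mult)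
  then show ?thesis
    using True by (simp add: distrib_left distrib_right mult.assoc add.commute)
next
  case False
  then have "g j * x = x * g j" "g j * g k = g k * g j"
    using assms comm by auto
  then show ?thesis
    by (simp add: distrib_left distrib_right mult.assoc) (metis mult.assoc)
qed

text \<open>The kernel of the commutator with \<open>g k\<close> on \<open>B I\<close> is the
  smaller centralizer, which also contains the image. Hence one more generator at most halves the
  dimension.\<close>

lemma dim_commuting_insert:
  assumes "I \<subseteq> {..<m}" "k < m"
  defines "B \<equiv> \<lambda>I. {x. \<forall>i\<in>I. g i * x = x * g i}"
  shows "dim ((\<lambda>x. g k * x + x * g k) ` B I) + dim (B (insert k I)) = dim (B I)"
    and "(\<lambda>x. g k * x + x * g k) ` B I \<subseteq> B (insert k I)"
proof -
  let ?f = "\<lambda>x. g k * x + x * g k"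
  show "?f ` B I \<subseteq> B (insert k I)"
    using commutator_in_commuting[OF assms(1,2)] by (auto simp: B_def)
  have "{x \<in> B I. ?f x = 0} = B (insert k I)"
    by (auto simp: B_def add_eq_0_iff_eq)
  moreover have "subspace (B I)"
    unfolding B_def by (rule subspace_commuting)
  ultimately show "dim (?f ` B I) + dim (B (insert k I)) = dim (B I)"
    using rank_nullity[OF linear_commutator[of "g k"], of "B I"] by simp
qed

lemma dim_le_commuting:
  "finite I \<Longrightarrow> I \<subseteq> {..<m} \<Longrightarrow>
    dim (UNIV :: 'a set) \<le> 2 ^ card I * dim {x. \<forall>i\<in>I. g i * x = x * g i}"
proof (induction I rule: finite_induct)
  case (insert k I)
  let ?B = "\<lambda>I. {x. \<forall>i\<in>I. g i * x = x * g i}"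
  have "dim (?B I) \<le> 2 * dim (?B (insert k I))"
    using dim_commuting_insert[of I k] insert.prems
      dim_subset[of "(\<lambda>x. g k * x + x * g k) ` ?B I" "?B (insert k I)"] by auto
  with insert show ?case
    by (auto intro: order_trans simp: mult.assoc)
qed simp

text \<open>Without \<open>g k\<close> the centralizer has dimension at least 4^m / 2^(m-1) = 2 *
  2^m. So the commutator with \<open>g k\<close> has rank at least 2^m, maps onto the full
  centralizer, and reaches 1.\<close>

lemma dual_exists:
  assumes dims: "dim (UNIV :: 'a set) = 4 ^ m" "dim {x. \<forall>i<m. g i * x = x * g i} = 2 ^ m"
    and k: "k < m"
  shows "\<exists>u. \<forall>i<m. g i * u + u * g i = of_bool (i = k)"
proof -
  let ?B = "\<lambda>I. {x. \<forall>i\<in>I. g i * x = x * g i}" and ?f = "\<lambda>x. g k * x + x * g k"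
  define I where "I = {..<m} - {k}"
  have I: "finite I" "I \<subseteq> {..<m}" "insert k I = {..<m}" "card I = m - 1"
    using k by (auto simp: I_def)
  have "4 ^ m \<le> 2 ^ (m - 1) * dim (?B I)"
    using dim_le_commuting[OF I(1,2)] dims I(4) by simp
  moreover have "(4::nat) ^ m = 2 ^ (m - 1) * (2 ^ m + 2 ^ m)"
    using k by (cases m) (simp_all flip: power_mult_distrib)
  ultimately have "2 ^ m + 2 ^ m \<le> dim (?B I)" by simp
  moreover have S: "?B (insert k I) = {x. \<forall>i<m. g i * x = x * g i}"
    unfolding I(3) by auto
  ultimately have "dim (?B (insert k I)) \<le> dim (?f ` ?B I)"
    using dim_commuting_insert(1)[OF I(2) k] dims by simp
  moreover interpret f: Vector_Spaces.linear smult smult ?f by (rule linear_commutator)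
  have "subspace (?f ` ?B I)" using f.subspace_image[OF subspace_commuting] .
  ultimately have "?f ` ?B I = ?B (insert k I)"
    using subspace_dim_equal subspace_commuting dim_commuting_insert(2)[OF I(2) k] by blast
  moreover have "1 \<in> ?B (insert k I)" by simp
  ultimately obtain u where u: "u \<in> ?B I" "1 = ?f u" by blast
  have "g i * u + u * g i = of_bool (i = k)" if "i < m" for i
    using u that by (auto simp: I_def add_eq_0_iff_eq)
  then show ?thesis by blast
qed

end

lemma centralizer_gen_subalgebra: "centralizer (gen_subalgebra smult X) = centralizer X"
proof (intro equalityI subsetI)
  fix x assume x: "x \<in> centralizer X"
  have "subalgebra smult {y. x * y = y * x}"
    by (auto simp: subalgebra_def algebra_simps mult_smult_left mult_smult_right)
      (metis mult.assoc)
  moreover have "X \<subseteq> {y. x * y = y * x}"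
    using x by (auto simp: centralizer_def)
  ultimately have "gen_subalgebra smult X \<subseteq> {y. x * y = y * x}"
    unfolding gen_subalgebra_def by (intro Inter_lower) simp
  then show "x \<in> centralizer (gen_subalgebra smult X)"
    by (auto simp: centralizer_def)
qed (auto simp: centralizer_def gen_subalgebra_def)

text \<open>A centralizer depends only on generators, so C_A(S) = S identifies S with the common
  centralizer \<open>C n\<close> of its generators.\<close>

theorem D_inv_inseparable:
  assumes S: "inseparable_subalgebra smult \<sigma> S" and orth: "orthogonal_char2 \<sigma>"
  shows "D_inv smult \<sigma> = {c. \<exists>x\<in>S. x \<noteq> 0 \<and> x * x = smult c 1}"
proof -
  obtain gs where dims: "dim (UNIV :: 'a set) = 4 ^ length gs" "dim S = 2 ^ length gs"
    and sub: "subalgebra smult S" "S \<subseteq> Sym_plus smult \<sigma>"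
    and cent: "centralizer S = S" and gen: "gen_subalgebra smult (set gs) = S"
    using S by (auto simp: inseparable_subalgebra_def)
  define g where "g i = gs ! i" for i
  let ?m = "length gs"
  have S_eq: "{x. \<forall>i<?m. g i * x = x * g i} = S"
  proof -
    have "S = centralizer (set gs)"
      using cent gen centralizer_gen_subalgebra by metis
    then show ?thesis by (force simp: centralizer_def g_def all_set_conv_all_nth)
  qed
  have gS: "g i \<in> S" if "i < ?m" for i
    using that gen by (auto simp: g_def gen_subalgebra_def)
  have comm: "g i * g j = g j * g i" if "i < ?m" "j < ?m" for i j
    using Sym_plus_commute[OF sub gS gS] that by blast
  have square: "x * x \<in> scalars smult" if "x \<in> S" for x
    using sub that by (auto simp: Sym_plus_def)
  have "\<exists>u. \<forall>i<?m. g i * u + u * g i = of_bool (i = k)" if "k < ?m" for k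
    using that comm square gS dims S_eq by (intro dual_exists) auto
  then obtain u where u: "\<And>i k. i < ?m \<Longrightarrow> k < ?m \<Longrightarrow> g i * u k + u k * g i = of_bool (i = k)"
    by metis
  interpret dual_system smult \<sigma> ?m g u
  proof
    fix s assume "\<And>i. i < ?m \<Longrightarrow> g i * s = s * g i"
    then have "s \<in> S" using S_eq by blast
    then show "\<sigma> s = s" "s * s \<in> scalars smult"
      using sub by (auto simp: Sym_plus_def Sym_def)
  qed (use comm u in auto)
  have "C ?m = S" using S_eq C_n_iff by blast
  then show ?thesis using D_inv_eq_squares[OF orth] by simp
qed

section \<open>Alternating units in quaternion algebras\<close>

context
  fixes Q a b
  assumes Q: "quaternion_subalgebra smult Q" and stable: "\<sigma> ` Q \<subseteq> Q" and orthQ: "1 \<notin> Alt \<sigma> Q"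
    and a: "a \<in> Alt \<sigma> Q" and b: "b \<in> Q" "a * b = 1" "b * a = 1"
begin

lemma subalgebra_quaternion: "subalgebra smult Q"
  using Q by (simp add: quaternion_subalgebra_def central_simple_on_def)

lemma quaternion_closed: "1 \<in> Q" "x \<in> Q \<Longrightarrow> y \<in> Q \<Longrightarrow> x + y \<in> Q" "x \<in> Q \<Longrightarrow> y \<in> Q \<Longrightarrow> x * y \<in> Q"
  "x \<in> Q \<Longrightarrow> smult c x \<in> Q" "x \<in> Q \<Longrightarrow> \<sigma> x \<in> Q" "a \<in> Q" "0 \<in> Q"
  using subalgebra_quaternion stable a by (auto simp: subalgebra_def Alt_iff image_subset_iff)

lemma Alt_unit_inv: "\<sigma> a = a"
  using a by (rule Alt_inv)

lemma Alt_unit_nonzero: "a \<noteq> 0"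
  using b orthQ AltI[OF quaternion_closed(7)] by auto

text \<open>\<open>Alt\<close> is the image of \<open>?f\<close> and lies in its kernel, properly
  because of 1. Rank and nullity add up to 4, so the rank is at most 1.\<close>

lemma Alt_quaternion: "Alt \<sigma> Q = range (\<lambda>c. smult c a)"
proof -
  let ?f = "\<lambda>x. x + \<sigma> x"
  let ?Y = "{x \<in> Q. ?f x = 0}"
  interpret f: Vector_Spaces.linear smult smult ?f by (rule linear_one_plus_inv)
  have im: "?f ` Q = Alt \<sigma> Q" by (auto simp: Alt_iff)
  have sub: "subspace Q" "subspace (Alt \<sigma> Q)" "subspace ?Y"
    using subalgebra_subspace[OF subalgebra_quaternion] f.subspace_image[of Q]
      f.subspace_kernel subspace_inter[of Q "{x. ?f x = 0}"] 
    by (simp_all add: im Collect_conj_eq)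
  have "Alt \<sigma> Q \<subseteq> ?Y" "1 \<in> ?Y"
    by (auto simp: Alt_iff add_ac quaternion_closed)
  then have "Alt \<sigma> Q \<subset> ?Y" using orthQ by blast
  then have "dim (Alt \<sigma> Q) < dim ?Y"
    using sub by (intro dim_psubset) (simp add: span_eq_iff[THEN iffD2])
  moreover have "dim (Alt \<sigma> Q) + dim ?Y = 4"
    using rank_nullity[OF linear_one_plus_inv sub(1)] Q by (simp add: im quaternion_subalgebra_def)
  ultimately have "dim (Alt \<sigma> Q) \<le> 1" by simp
  moreover have "span {a} \<subseteq> Alt \<sigma> Q"
    using a sub by (intro span_minimal) auto
  ultimately have "span {a} = Alt \<sigma> Q"
    using Alt_unit_nonzero sub by (intro subspace_dim_equal) auto
  then show ?thesis by (simp add: span_singleton)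
qed

lemma Alt_unit_not_scalar: "a \<noteq> smult d 1"
proof
  assume *: "a = smult d 1"
  then have "d \<noteq> 0" using Alt_unit_nonzero by auto
  then have "smult (1 / d) a = 1" using * by simp
  then show False using Alt_quaternion orthQ by (metis rangeI)
qed

text \<open>\<open>a\<^sup>3 = a a \<sigma>(a)\<close> is alternating, hence a multiple of \<open>a\<close>.\<close>

lemma Alt_unit_square: "\<exists>c. c \<noteq> 0 \<and> a * a = smult c 1"
proof -
  obtain x where x: "x \<in> Q" "a = x + \<sigma> x" using a by (auto simp: Alt_iff)
  have "a * x * a + \<sigma> (a * x * a) \<in> Alt \<sigma> Q"
    using x by (intro AltI quaternion_closed)
  moreover have "a * x * a + \<sigma> (a * x * a) = a * (x + \<sigma> x) * a"
    by (simp add: Alt_unit_inv algebra_simps)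
  ultimately obtain c where c: "a * a * a = smult c a"
    using Alt_quaternion x(2) by auto
  then have "a * a * a * b = smult c (a * b)" by (simp add: mult_smult_left)
  then have eq: "a * a = smult c 1" using b by (simp add: mult.assoc)
  moreover have "c \<noteq> 0"
  proof
    assume "c = 0"
    then have "a * (a * b) = 0" using eq by (simp flip: mult.assoc)
    then show False using b Alt_unit_nonzero by simp
  qed
  ultimately show ?thesis by blast
qed

text \<open>If \<open>[a, _]\<close> vanishes on symmetric elements, then its image is a line. This makes a translate
  \<open>\<beta>\<close> of \<open>a\<close> nilpotent with \<open>Q \<beta>\<close> a two-sided ideal, contradicting simplicity.\<close>

lemma Alt_unit_dual: "\<exists>u\<in>Q. a * u + u * a = 1"
proof (cases "\<exists>s\<in>Q. \<sigma> s = s \<and> a * s + s * a \<noteq> 0")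
  case True
  then obtain s where s: "s \<in> Q" "\<sigma> s = s" "a * s + s * a \<noteq> 0" by blast
  have "a * s + \<sigma> (a * s) \<in> Alt \<sigma> Q" by (intro AltI quaternion_closed s)
  then obtain k where k: "a * s + s * a = smult k a"
    using Alt_quaternion s Alt_unit_inv by auto
  have "k \<noteq> 0" using k s(3) by auto
  \<comment> \<open>The inverse \<open>b\<close> commutes with \<open>a\<close>, so it turns the
    commutator \<open>smult k a\<close> into the scalar \<open>k\<close>.\<close>
  have "a * (s * b) + (s * b) * a = (a * s + s * a) * b"
    using b by (simp add: distrib_right mult.assoc)
  also have "\<dots> = smult k 1" using b by (simp add: k mult_smult_left)
  finally have "a * smult (1 / k) (s * b) + smult (1 / k) (s * b) * a = 1"
    using \<open>k \<noteq> 0\<close> by (simp add: mult_smult_left mult_smult_right flip: scale_right_distrib)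
  then show ?thesis using s b quaternion_closed by metis
next
  case False
  obtain c where c: "c \<noteq> 0" "a * a = smult c 1" using Alt_unit_square by blast
  obtain y where y: "y \<in> Q" "a = y + \<sigma> y" using a by (auto simp: Alt_iff)
  have sy: "\<sigma> y = y + a" using y(2) by (metis double_left)
  have "a * y + \<sigma> (a * y) \<in> Alt \<sigma> Q" by (intro AltI quaternion_closed y)
  then obtain l where "a * y + (y * a + a * a) = smult l a"
    using Alt_quaternion by (auto simp: Alt_unit_inv sy distrib_right)
  then have "a * y + y * a + smult c 1 = smult l a"
    by (simp add: c(2) add.assoc)
  then have Dy: "a * y + y * a = smult c 1 + smult l a"
    by (metis add.commute double_left)
  define d where "d = smult c 1 + smult l a"
  have d: "d \<noteq> 0"
  proof
    assume "d = 0"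
    then have eq: "smult l a = smult c 1" by (simp add: d_def add_eq_0_iff_eq)
    show False
    proof (cases "l = 0")
      case True
      moreover have "(1::'a) \<noteq> 0" using b Alt_unit_nonzero by auto
      ultimately show ?thesis using eq c(1) by auto
    next
      case False
      then have "a = smult (c / l) 1" 
        using arg_cong[OF eq, of "smult (1 / l)"] by simp
      then show ?thesis using Alt_unit_not_scalar by blast
    qed
  qed
  \<comment> \<open>A suitable multiple of \<open>y\<close> makes \<open>z\<close> symmetric, and
    there the commutator vanishes in this case.\<close>
  have Dd: "\<exists>k. a * z + z * a = smult k d" if z: "z \<in> Q" for z
  proof -
    have "z + \<sigma> z \<in> Alt \<sigma> Q" by (intro AltI z)
    then obtain k where k: "z + \<sigma> z = smult k a" using Alt_quaternion by auto
    define s where "s = z + smult k y"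
    have "\<sigma> z = z + smult k a" using k by (metis double_left)
    then have "\<sigma> s = s"
      by (simp add: s_def sy scale_right_distrib add_ac)
    moreover have "s \<in> Q" using z y by (simp add: s_def quaternion_closed)
    ultimately have "a * s + s * a = 0" using False by blast
    moreover have "a * s + s * a = (a * z + z * a) + smult k (a * y + y * a)"
      by (simp add: s_def algebra_simps mult_smult_left mult_smult_right scale_right_distrib)
    ultimately show ?thesis unfolding d_def Dy by (metis add_eq_0_iff_eq)
  qed
  obtain \<mu> where "a * (y * a) + (y * a) * a = smult \<mu> d"
    using Dd[of "y * a"] y quaternion_closed by blast
  then have \<mu>: "d * a = smult \<mu> d"
    unfolding d_def Dy[symmetric] by (simp add: distrib_right mult.assoc)
  \<comment> \<open>Right multiplication by \<open>a\<close> scales \<open>d\<close> by \<mu>, so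
    this translate annihilates \<open>d\<close>; its scalar square must then vanish.\<close>
  define \<beta> where "\<beta> = a + smult \<mu> 1"
  have d\<beta>: "d * \<beta> = 0"
    by (simp add: \<beta>_def distrib_left \<mu> mult_smult_right)
  have \<beta>: "\<beta> \<noteq> 0" "\<beta> \<in> Q"
    using Alt_unit_not_scalar by (auto simp: \<beta>_def add_eq_0_iff_eq quaternion_closed)
  have "\<beta> * \<beta> = smult (c + \<mu> * \<mu>) 1"
    by (simp add: \<beta>_def algebra_simps c(2) mult_smult_left mult_smult_right scale_left_distrib)
  moreover from this have "smult (c + \<mu> * \<mu>) d = 0"
    using d\<beta> by (metis mult.assoc mult_zero_left smult_1_mult(2))
  ultimately have \<beta>\<beta>: "\<beta> * \<beta> = 0" using d by simp
  have d_eq: "d = smult (c + l * \<mu>) 1 + smult l \<beta>"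
    by (simp add: d_def \<beta>_def scale_right_distrib scale_left_distrib add_ac)
  have "smult (c + l * \<mu>) \<beta> = 0"
    using d\<beta> by (simp add: d_eq distrib_right smult_1_mult \<beta>\<beta> mult_smult_left)
  then have d_eq: "d = smult l \<beta>" using d_eq \<beta> by simp
  \<comment> \<open>Commutators with \<beta> are multiples of \<open>d\<close>, hence of \<beta>;
    this makes the left ideal \<open>I\<close> two-sided.\<close>
  have \<beta>_comm: "\<exists>k. \<beta> * z = z * \<beta> + smult k \<beta>" if "z \<in> Q" for z
  proof -
    have "\<beta> * z + z * \<beta> = a * z + z * a"
      by (simp add: \<beta>_def algebra_simps smult_1_mult)
    with Dd[OF that] obtain k where "\<beta> * z + z * \<beta> = smult (k * l) \<beta>"
      by (auto simp: d_eq)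
    then show ?thesis by (metis add.commute double_left)
  qed
  define I where "I = (\<lambda>z. z * \<beta>) ` Q"
  have "ideal_in Q I"
    unfolding ideal_in_def
  proof (intro conjI ballI)
    fix x s assume "x \<in> I" and s: "s \<in> Q"
    then obtain z where z: "z \<in> Q" "x = z * \<beta>" by (auto simp: I_def)
    show "s * x \<in> I" using z s by (auto simp: I_def quaternion_closed simp flip: mult.assoc)
    obtain k where "\<beta> * s = s * \<beta> + smult k \<beta>" using \<beta>_comm[OF s] by blast
    then have "x * s = (z * s + smult k z) * \<beta>"
      using z by (simp add: mult.assoc distrib_left distrib_right mult_smult_left mult_smult_right)
    then show "x * s \<in> I" using z s by (auto simp: I_def quaternion_closed)
  qed (use \<beta> quaternion_closed in \<open>auto simp: I_def simp flip: distrib_right intro: rev_image_eqI[of 0]\<close>)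
  then have "I = {0} \<or> I = Q"
    using Q by (auto simp: quaternion_subalgebra_def central_simple_on_def)
  then show ?thesis
  proof
    assume "I = {0}"
    moreover have "1 * \<beta> \<in> I" using quaternion_closed unfolding I_def by blast
    ultimately show ?thesis using \<beta> by simp
  next
    assume "I = Q"
    then have "1 \<in> I" using quaternion_closed(1) by simp
    then obtain z where "1 = z * \<beta>" unfolding I_def by blast
    then have "\<beta> = z * (\<beta> * \<beta>)" by (metis mult.assoc mult_1_left)
    then show ?thesis using \<beta> \<beta>\<beta> by simp
  qed
qed

text \<open>The commutator with \<open>a\<close> squares to zero and sends \<open>u * x\<close> to
  \<open>x\<close> for \<open>x\<close> commuting with \<open>a\<close>. So image and kernel agree,
  and the kernel has dimension 2.\<close>

lemma Alt_unit_centralizer: 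
  assumes "z \<in> Q" "a * z = z * a"
  shows "\<exists>c d. z = smult c 1 + smult d a"
proof -
  let ?f = "\<lambda>x. a * x + x * a"
  let ?Z = "{x \<in> Q. ?f x = 0}"
  interpret f: Vector_Spaces.linear smult smult ?f by (rule linear_commutator)
  have sub: "subspace Q" "subspace ?Z"
    using subalgebra_subspace[OF subalgebra_quaternion] 
      f.subspace_kernel subspace_inter[of Q "{x. ?f x = 0}"] 
    by (simp_all add: Collect_conj_eq)
  obtain u where u: "u \<in> Q" "a * u + u * a = 1" using Alt_unit_dual by blast
  have aa: "a * a * x = x * (a * a)" for x
    using Alt_unit_square by (auto simp: smult_1_mult)
  have "?f ` Q = ?Z"
  proof (intro equalityI subsetI)
    fix x assume "x \<in> ?f ` Q"
    then show "x \<in> ?Z" using aa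
      by (auto simp: quaternion_closed distrib_left distrib_right mult.assoc add.commute)
  next
    fix x assume x: "x \<in> ?Z"
    then have "a * x = x * a" by (simp add: add_eq_0_iff_eq)
    then have "?f (u * x) = (a * u + u * a) * x"
      by (simp add: distrib_right mult.assoc)
    then show "x \<in> ?f ` Q" using u x
      by (metis (no_types, lifting) quaternion_closed(3) imageI mem_Collect_eq mult_1_left)
  qed
  then have dim: "dim ?Z = 2"
    using rank_nullity[OF linear_commutator sub(1), of a] Q 
    by (simp add: quaternion_subalgebra_def)
  have "a \<notin> span {1}" using Alt_unit_not_scalar by (auto simp: span_singleton)
  moreover have "(1::'a) \<noteq> 0" using b Alt_unit_nonzero by auto
  ultimately have "dim {a, 1} = 2" by (simp add: dim_insert)
  then have "span {a, 1} = ?Z"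
    using sub dim by (intro subspace_dim_equal span_minimal) (auto simp: quaternion_closed)
  then have "z \<in> span {a, 1}" using assms by simp
  then obtain d where "z - smult d a \<in> span {1}"
    unfolding span_insert by blast
  then obtain c where "z - smult d a = smult c 1"
    unfolding span_singleton by blast
  then have "z = smult c 1 + smult d a" by (metis diff_add_cancel)
  then show ?thesis by blast
qed

text \<open>As \<open>a\<close> is not scalar, its monic quadratic relation is unique, so the
  description in \<open>quat_nrd\<close> selects the scalar \<open>a * a\<close>.\<close>

lemma Alt_unit_quat_nrd: "a * a = smult (quat_nrd smult a) 1"
proof -
  obtain c where c: "a * a = smult c 1" using Alt_unit_square by blast
  have "d = c" if "a * a - smult t a + smult d 1 = 0" for d t
  proof -
    have "smult t a = smult (c + d) 1"
      using that by (simp add: c scale_left_distrib add_ac) (metis add.commute add_eq_0_iff_eq add.assoc)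
    moreover have "t = 0"
    proof (rule ccontr)
      assume "t \<noteq> 0"
      then have "a = smult ((c + d) / t) 1" 
        using arg_cong[OF calculation, of "smult (1 / t)"] by simp
      then show False using Alt_unit_not_scalar by blast
    qed
    moreover have "(1::'a) \<noteq> 0" using b Alt_unit_nonzero by auto
    ultimately have "c + d = 0" by simp
    then show ?thesis by (metis add_left_cancel field_double)
  qed
  moreover have "a * a - smult 0 a + smult c 1 = 0" by (simp add: c)
  ultimately have "(THE d. \<exists>t. a * a - smult t a + smult d 1 = 0) = c"
    by (intro the_equality) blast+
  moreover have "a \<notin> scalars smult" using Alt_unit_not_scalar by (auto simp: scalars_def)
  ultimately show ?thesis by (simp add: c quat_nrd_def)
qed

end

text \<open>Rescaling the alternating unit by \<open>e\<close> realizes the chosen representative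
  \<alpha> exactly, and \<open>u\<close> is rescaled inversely.\<close>

lemma represents_disc_generators:
  assumes Q: "quaternion_subalgebra smult Q" "\<sigma> ` Q \<subseteq> Q" "1 \<notin> Alt \<sigma> Q"
    and disc: "represents_disc smult \<sigma> Q \<alpha>"
  shows "\<exists>v\<in>Q. \<exists>u\<in>Q. \<sigma> v = v \<and> v * v = smult \<alpha> 1 \<and> v * u + u * v = 1 \<and>
    (\<forall>z\<in>Q. v * z = z * v \<longrightarrow> (\<exists>c d. z = smult c 1 + smult d v))"
proof -
  obtain a b e where a: "a \<in> Alt \<sigma> Q" and b: "b \<in> Q" "a * b = 1" "b * a = 1"
    and e: "e \<noteq> 0" "\<alpha> = - quat_nrd smult a * e ^ 2"
    using disc by (auto simp: represents_disc_def)
  note A = Q a b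
  obtain u where u: "u \<in> Q" "a * u + u * a = 1" using Alt_unit_dual[OF A] by blast
  have "\<alpha> = quat_nrd smult a * e ^ 2"
    using e(2) by (metis add_eq_0_iff field_double mult_minus_left)
  then have "smult e a * smult e a = smult \<alpha> 1"
    by (simp add: scalar_mult_self Alt_unit_quat_nrd[OF A, symmetric] mult.commute) 
      (metis Alt_unit_quat_nrd[OF A] mult.commute scale_scale)
  moreover have "smult e a * smult (1 / e) u + smult (1 / e) u * smult e a = 1"
    using u e by (simp add: mult_smult_left mult_smult_right)
  moreover have "\<exists>c d. z = smult c 1 + smult d (smult e a)"
    if z: "z \<in> Q" "smult e a * z = z * smult e a" for z
  proof -
    have "a * z = z * a" using z e by (simp add: mult_smult_left mult_smult_right)
    then obtain c d where "z = smult c 1 + smult d a" using Alt_unit_centralizer[OF A z(1)] by blast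
    then have "z = smult c 1 + smult (d / e) (smult e a)" using e by simp
    then show ?thesis by blast
  qed
  moreover have "smult e a \<in> Q" "smult (1 / e) u \<in> Q" "\<sigma> (smult e a) = smult e a"
    using quaternion_closed[OF A] u Alt_unit_inv[OF A] by auto
  ultimately show ?thesis by blast
qed

end

section \<open>Tensor decompositions and the Pfister form\<close>

lemma foldr_mult_left:
  fixes p t :: "'a::monoid_mult"
  shows "(\<And>i. i \<in> set xs \<Longrightarrow> p * q i = q i * p) \<Longrightarrow>
    p * foldr (\<lambda>i acc. q i * acc) xs t = foldr (\<lambda>i acc. q i * acc) xs (p * t)"
proof (induction xs)
  case (Cons i xs)
  then have "p * (q i * foldr (\<lambda>i acc. q i * acc) xs t)
      = q i * (p * foldr (\<lambda>i acc. q i * acc) xs t)"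
    by (metis list.set_intros(1) mult.assoc)
  with Cons show ?case by simp
qed simp

lemma foldr_mult_right:
  fixes p t :: "'a::monoid_mult"
  shows "foldr (\<lambda>i acc. q i * acc) xs t * p = foldr (\<lambda>i acc. q i * acc) xs (t * p)"
  by (induction xs) (auto simp: mult.assoc)

lemma ord_prod_split:
  assumes "k < n"
  shows "ord_prod n q = foldr (\<lambda>i acc. q i * acc) [0..<k]
    (q k * foldr (\<lambda>i acc. q i * acc) [Suc k..<n] 1)"
proof -
  have "[0..<n] = [0..<k] @ k # [Suc k..<n]"
    using assms by (metis le_add_same_cancel1 less_imp_le_nat upt_add_eq_append upt_conv_Cons zero_le
        le_add_diff_inverse)
  then show ?thesis by (simp add: ord_prod_def)
qed

lemma ord_prod_upd:
  assumes "k < n"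
  shows "ord_prod n (q(k := x)) = foldr (\<lambda>i acc. q i * acc) [0..<k]
    (x * foldr (\<lambda>i acc. q i * acc) [Suc k..<n] 1)"
  unfolding ord_prod_split[OF assms] by (auto intro!: foldr_cong arg_cong2[where f = "(*)"])

lemma ord_prod_Suc: "ord_prod (Suc n) q = ord_prod n q * q n"
  by (simp add: ord_prod_def foldr_mult_right)

text \<open>Applied to \<open>p\<close> in the \<open>k\<close>-th tensor factor: multiplication by
  it changes no other factor.\<close>

lemma mult_ord_prod:
  assumes "k < n" "\<And>i. i < n \<Longrightarrow> i \<noteq> k \<Longrightarrow> p * q i = q i * p"
  shows "p * ord_prod n q = ord_prod n (q(k := p * q k))"
    and "ord_prod n q * p = ord_prod n (q(k := q k * p))"
proof -
  have "p * foldr (\<lambda>i acc. q i * acc) [0..<k] t = foldr (\<lambda>i acc. q i * acc) [0..<k] (p * t)" for t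
    by (rule foldr_mult_left) (use assms in auto)
  then show "p * ord_prod n q = ord_prod n (q(k := p * q k))"
    unfolding ord_prod_split[OF assms(1), of q] ord_prod_upd[OF assms(1)]
    by (simp add: mult.assoc)
  have "p * foldr (\<lambda>i acc. q i * acc) [Suc k..<n] 1 = foldr (\<lambda>i acc. q i * acc) [Suc k..<n] (p * 1)"
    by (rule foldr_mult_left) (use assms in auto)
  then have "p * foldr (\<lambda>i acc. q i * acc) [Suc k..<n] 1 = foldr (\<lambda>i acc. q i * acc) [Suc k..<n] 1 * p"
    by (simp add: foldr_mult_right)
  then show "ord_prod n q * p = ord_prod n (q(k := q k * p))"
    unfolding ord_prod_split[OF assms(1), of q] ord_prod_upd[OF assms(1)]
    by (simp add: foldr_mult_right mult.assoc)
qed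

context char2_algebra_involution
begin

lemma ord_prod_add:
  fixes q :: "nat \<Rightarrow> 'a"
  shows "k < n \<Longrightarrow> ord_prod n (q(k := x)) + ord_prod n (q(k := y)) = ord_prod n (q(k := x + y))"
proof -
  have *: "foldr (\<lambda>i acc. q i * acc) xs s + foldr (\<lambda>i acc. q i * acc) xs t
      = foldr (\<lambda>i acc. q i * acc) xs (s + t)" for xs and s t :: 'a
    by (induction xs) (auto simp flip: distrib_left)
  assume "k < n"
  then show ?thesis by (simp add: ord_prod_upd * distrib_right)
qed

text \<open>The linear combination with coefficients \<open>c I\<close> of the products of the
  \<open>v i\<close> with \<open>i\<close> in \<open>I\<close>, largest index leftmost. The
  recursion splits by whether \<open>k\<close> lies in \<open>I\<close>, as adding a slot to a
  Pfister form does.\<close>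

fun pfister_elem :: "(nat \<Rightarrow> 'a) \<Rightarrow> (nat set \<Rightarrow> 'f) \<Rightarrow> nat \<Rightarrow> 'a" where
  "pfister_elem v c 0 = smult (c {}) 1"
| "pfister_elem v c (Suc k) = pfister_elem v c k + v k * pfister_elem v (\<lambda>I. c (insert k I)) k"

lemma pfister_elem_cong:
  "(\<And>I. I \<subseteq> {..<k} \<Longrightarrow> c I = c' I) \<Longrightarrow> pfister_elem v c k = pfister_elem v c' k"
proof (induction k arbitrary: c c')
  case (Suc k)
  have "pfister_elem v c k = pfister_elem v c' k"
    by (intro Suc.IH Suc.prems) auto
  moreover have "pfister_elem v (\<lambda>I. c (insert k I)) k = pfister_elem v (\<lambda>I. c' (insert k I)) k"
    by (intro Suc.IH Suc.prems) auto
  ultimately show ?case by simp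
qed simp

lemma pfister_elem_Suc_ex:
  "\<exists>e. pfister_elem v c k + v k * pfister_elem v d k = pfister_elem v e (Suc k)"
proof
  let ?e = "\<lambda>I. if k \<in> I then d (I - {k}) else c I"
  have "pfister_elem v ?e k = pfister_elem v c k"
    by (rule pfister_elem_cong) auto
  moreover have "pfister_elem v (\<lambda>I. ?e (insert k I)) k = pfister_elem v d k"
    by (rule pfister_elem_cong) (auto intro!: arg_cong[of _ _ d])
  ultimately show "pfister_elem v c k + v k * pfister_elem v d k = pfister_elem v ?e (Suc k)"
    by simp
qed

lemma pfister_elem_add:
  "pfister_elem v c k + pfister_elem v d k = pfister_elem v (\<lambda>I. c I + d I) k"
proof (induction k arbitrary: c d)
  case (Suc k)
  show ?case by (simp add: distrib_left add_ac flip: Suc)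
qed (simp add: scale_left_distrib)

lemma pfister_elem_smult:
  "smult r (pfister_elem v c k) = pfister_elem v (\<lambda>I. r * c I) k"
  by (induction k arbitrary: c) (simp_all add: scale_right_distrib flip: mult_smult_right)

lemma pfister_elem_0: "pfister_elem v (\<lambda>I. 0) k = 0"
  using pfister_elem_smult[of 0 v _ k] by simp

lemma subspace_pfister_elem: "subspace (range (\<lambda>c. pfister_elem v c k))"
proof -
  have "0 \<in> range (\<lambda>c. pfister_elem v c k)"
    by (metis pfister_elem_0 rangeI)
  then show ?thesis
    by (auto simp: subspace_def pfister_elem_add pfister_elem_smult)
qed

lemma pfister_elem_commute:
  "(\<And>i. i < k \<Longrightarrow> x * v i = v i * x) \<Longrightarrow> x * pfister_elem v c k = pfister_elem v c k * x"
proof (induction k arbitrary: c)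
  case (Suc k)
  then show ?case
    by (simp add: distrib_left distrib_right mult.assoc) (metis lessI mult.assoc)
qed (simp add: smult_1_mult)

lemma sum_Pow_Suc:
  fixes f :: "nat set \<Rightarrow> 'b::comm_monoid_add"
  shows "sum f (Pow {..<Suc k}) = sum f (Pow {..<k}) + (\<Sum>I\<in>Pow {..<k}. f (insert k I))"
proof -
  have "inj_on (insert k) (Pow {..<k})"
    by (auto simp: inj_on_def)
  then show ?thesis
    unfolding lessThan_Suc Pow_insert
    by (subst sum.union_disjoint) (auto simp: sum.reindex)
qed

end

section \<open>The commuting algebra of a tensor decomposition\<close>

locale pfister_generators = fin_dim_involution smult \<sigma> Basis
  for smult :: "'f::field \<Rightarrow> 'a::ring_1 \<Rightarrow> 'a" and \<sigma> Basis +
  fixes n :: nat and Q :: "nat \<Rightarrow> 'a set" and u v :: "nat \<Rightarrow> 'a" and \<alpha> :: "nat \<Rightarrow> 'f"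
  assumes decomp: "tensor_decomposition smult \<sigma> n Q"
    and v_in: "i < n \<Longrightarrow> v i \<in> Q i" and u_in: "i < n \<Longrightarrow> u i \<in> Q i"
    and v_inv: "i < n \<Longrightarrow> \<sigma> (v i) = v i"
    and v_square: "i < n \<Longrightarrow> v i * v i = smult (\<alpha> i) 1"
    and vu: "i < n \<Longrightarrow> v i * u i + u i * v i = 1"
    and v_cent: "i < n \<Longrightarrow> z \<in> Q i \<Longrightarrow> v i * z = z * v i \<Longrightarrow> \<exists>c d. z = smult c 1 + smult d (v i)"
    and orth: "orthogonal_char2 \<sigma>"
begin

abbreviation elem :: "(nat set \<Rightarrow> 'f) \<Rightarrow> nat \<Rightarrow> 'a" where
  "elem \<equiv> pfister_elem v"

lemma Q_commute: "i < n \<Longrightarrow> j < n \<Longrightarrow> i \<noteq> j \<Longrightarrow> x \<in> Q i \<Longrightarrow> y \<in> Q j \<Longrightarrow> x * y = y * x"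
  using decomp by (simp add: tensor_decomposition_def)

lemma v_commute: "i < n \<Longrightarrow> j < n \<Longrightarrow> v i * v j = v j * v i"
  using Q_commute[of i j] v_in by (cases "i = j") auto

lemma subalgebra_Q: "i < n \<Longrightarrow> subalgebra smult (Q i)"
  using decomp by (simp add: tensor_decomposition_def quaternion_subalgebra_def central_simple_on_def)

lemma elem_v_commute: "i < n \<Longrightarrow> k \<le> n \<Longrightarrow> v i * elem c k = elem c k * v i"
  by (rule pfister_elem_commute) (simp add: v_commute)

lemma elem_inv: "k \<le> n \<Longrightarrow> \<sigma> (elem c k) = elem c k"
  by (induction k arbitrary: c) (simp_all add: v_inv elem_v_commute)

text \<open>All factors commute, so in characteristic two the cross terms cancel: the squaring map
  is the diagonal Pfister form in the coordinates \<open>c\<close>.\<close>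

lemma elem_square:
  "k \<le> n \<Longrightarrow> elem c k * elem c k = smult (\<Sum>I\<in>Pow {..<k}. (\<Prod>i\<in>I. \<alpha> i) * c I ^ 2) 1"
proof (induction k arbitrary: c)
  case 0
  then show ?case by (simp add: mult_smult_left power2_eq_square)
next
  case (Suc k)
  let ?x = "elem c k" and ?y = "elem (\<lambda>I. c (insert k I)) k"
  have xy: "?x * ?y = ?y * ?x"
    using Suc.prems by (intro pfister_elem_commute) (simp add: elem_v_commute)
  have vx: "v k * ?x = ?x * v k" and vy: "v k * ?y = ?y * v k"
    using Suc.prems by (simp_all add: elem_v_commute)
  have "?x * (v k * ?y) = (v k * ?y) * ?x"
    by (metis mult.assoc vx xy)
  then have "elem c (Suc k) * elem c (Suc k) = ?x * ?x + (v k * ?y) * (v k * ?y)"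
    by (simp add: distrib_left distrib_right add_ac)
  also have "(v k * ?y) * (v k * ?y) = v k * (?y * v k) * ?y"
    by (simp add: mult.assoc)
  also have "\<dots> = (v k * v k) * (?y * ?y)"
    unfolding vy[symmetric] by (simp add: mult.assoc)
  also have "\<dots> = smult (\<alpha> k) (?y * ?y)"
    using Suc.prems by (simp add: v_square smult_1_mult)
  finally have "elem c (Suc k) * elem c (Suc k) = ?x * ?x + smult (\<alpha> k) (?y * ?y)" .
  moreover have "(\<Sum>I\<in>Pow {..<k}. (\<Prod>i\<in>insert k I. \<alpha> i) * c (insert k I) ^ 2)
      = \<alpha> k * (\<Sum>I\<in>Pow {..<k}. (\<Prod>i\<in>I. \<alpha> i) * c (insert k I) ^ 2)"
    unfolding sum_distrib_left
  proof (intro sum.cong refl)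
    fix I assume "I \<in> Pow {..<k}"
    then have "finite I" "k \<notin> I" by (auto intro: finite_subset)
    then show "(\<Prod>i\<in>insert k I. \<alpha> i) * c (insert k I) ^ 2 = \<alpha> k * ((\<Prod>i\<in>I. \<alpha> i) * c (insert k I) ^ 2)"
      by simp
  qed
  ultimately show ?case
    using Suc by (simp add: sum_Pow_Suc scale_left_distrib)
qed

text \<open>The commutator with \<open>u k\<close> kills everything built from the earlier
  \<open>v i\<close> and sends \<open>v k\<close> to 1, so it isolates the part containing
  \<open>v k\<close>.\<close>

lemma elem_independent: "k \<le> n \<Longrightarrow> elem c k = 0 \<Longrightarrow> I \<subseteq> {..<k} \<Longrightarrow> c I = 0"
proof (induction k arbitrary: c I)
  case 0
  have "(1::'a) \<noteq> 0"
    using orth AltI[of 0 UNIV] by (auto simp: orthogonal_char2_def)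
  then show ?case using 0 by auto
next
  case (Suc k)
  let ?y = "elem (\<lambda>I. c (insert k I)) k"
  have u: "u k * elem d k = elem d k * u k" for d
  proof (rule pfister_elem_commute)
    fix i assume "i < k"
    then show "u k * v i = v i * u k"
      using Suc.prems Q_commute[of k i "u k" "v i"] u_in v_in by simp
  qed
  have "u k * elem c (Suc k) + elem c (Suc k) * u k = (v k * u k + u k * v k) * ?y"
    by (simp add: distrib_left distrib_right u mult.assoc add_ac)
  then have y: "?y = 0" using Suc.prems vu by simp
  then have x: "elem c k = 0" using Suc.prems by simp
  show ?case
  proof (cases "k \<in> I")
    case True
    then have "c (insert k (I - {k})) = 0"
      using Suc.prems y by (intro Suc.IH) auto
    then show ?thesis using True by (simp add: insert_absorb)
  next
    case False
    then show ?thesis using Suc.prems x by (intro Suc.IH) (auto simp: less_Suc_eq)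
  qed
qed

lemma ord_prod_elem:
  "k \<le> n \<Longrightarrow> (\<And>i. i < k \<Longrightarrow> \<exists>c d. q i = smult c 1 + smult d (v i)) \<Longrightarrow>
    ord_prod k q \<in> range (\<lambda>c. elem c k)"
proof (induction k)
  case 0
  have "elem (\<lambda>I. 1) 0 = 1" by simp
  then show ?case by (metis ord_prod_def foldr.simps(1) id_apply rangeI upt_0)
next
  case (Suc k)
  then obtain e where e: "ord_prod k q = elem e k" by fastforce
  obtain c d where "q k = smult c 1 + smult d (v k)" using Suc.prems by blast
  then have "ord_prod (Suc k) q = elem (\<lambda>I. c * e I) k + v k * elem (\<lambda>I. d * e I) k"
    using Suc.prems by (simp add: ord_prod_Suc e distrib_left mult_smult_right elem_v_commute
        flip: pfister_elem_smult)
  then show ?case using pfister_elem_Suc_ex by (metis rangeI)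
qed

text \<open>Interpolates between the whole algebra for \<open>k = 0\<close> and, for
  \<open>k = n\<close>, products whose factors are combinations of 1 and \<open>v i\<close> by
  \<open>v_cent\<close>.\<close>

definition W :: "nat \<Rightarrow> 'a set" where
  "W k = span {ord_prod n q |q. (\<forall>i<n. q i \<in> Q i) \<and> (\<forall>i<k. v i * q i = q i * v i)}"

text \<open>The map \<open>x \<mapsto> x + u\<^sub>k [v\<^sub>k, x]\<close> is a projection onto the centralizer of \<open>v\<^sub>k\<close> that affects only the
  factor from \<open>Q\<^sub>k\<close>.\<close>

lemma proj_W:
  assumes k: "k < n" and x: "x \<in> W k"
  shows "x + u k * (v k * x + x * v k) \<in> W (Suc k)"
proof -
  let ?f = "\<lambda>x. x + u k * (v k * x + x * v k)"
  interpret f: Vector_Spaces.linear smult smult ?f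
    by unfold_locales (simp_all add: algebra_simps scale_right_distrib mult_smult_left mult_smult_right)
  have "?f (ord_prod n q) \<in> W (Suc k)"
    if q: "\<forall>i<n. q i \<in> Q i" "\<forall>i<k. v i * q i = q i * v i" for q
  proof -
    have comm: "v k * q i = q i * v k" "u k * q i = q i * u k" if "i < n" "i \<noteq> k" for i
      using Q_commute[of k i] that k q u_in v_in by auto
    define z where "z = v k * q k + q k * v k"
    have "v k * ord_prod n q + ord_prod n q * v k = ord_prod n (q(k := z))"
      using mult_ord_prod[OF k comm(1)] ord_prod_add[OF k] by (simp add: z_def)
    moreover have "u k * ord_prod n (q(k := z)) = ord_prod n (q(k := u k * z))"
      using mult_ord_prod(1)[of k n "u k" "q(k := z)"] comm k by simp
    moreover have "ord_prod n q = ord_prod n (q(k := q k))" by simp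
    ultimately have eq: "?f (ord_prod n q) = ord_prod n (q(k := q k + u k * z))"
      using ord_prod_add[OF k] by metis
    have "v k * v k * q k = q k * (v k * v k)"
      by (simp add: v_square k smult_1_mult)
    then have vz: "v k * z = z * v k"
      by (simp add: z_def distrib_left distrib_right mult.assoc add.commute)
    \<comment> \<open>Since \<open>z\<close> commutes with \<open>v k\<close>, the commutator of
      \<open>v k\<close> with \<open>u k * z\<close> is \<open>z\<close>, which cancels that with
      \<open>q k\<close>.\<close>
    have "v k * (q k + u k * z) + (q k + u k * z) * v k
        = (v k * q k + q k * v k) + (v k * (u k * z) + u k * (z * v k))"
      by (simp add: distrib_left distrib_right mult.assoc add_ac)
    also have "\<dots> = z + (v k * u k + u k * v k) * z"
      unfolding vz[symmetric] z_def[symmetric] by (simp add: distrib_right mult.assoc)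
    also have "\<dots> = 0" using vu[OF k] by simp
    finally have "v k * (q k + u k * z) = (q k + u k * z) * v k"
      by (simp add: add_eq_0_iff_eq)
    moreover have "q k + u k * z \<in> Q k"
      using subalgebra_Q[OF k] q k u_in v_in by (simp add: subalgebra_def z_def)
    ultimately show ?thesis unfolding eq W_def
      using q by (intro span_base) (auto simp: less_Suc_eq)
  qed
  then have "?f ` W k \<subseteq> W (Suc k)"
    unfolding W_def f.span_image[symmetric] by (intro span_minimal) auto
  then show ?thesis using x by blast
qed

text \<open>Such an \<open>x\<close> is fixed by every projection of \<open>proj_W\<close>, so it
  descends through all \<open>W k\<close>.\<close>

lemma commuting_in_W: "k \<le> n \<Longrightarrow> (\<And>i. i < n \<Longrightarrow> v i * x = x * v i) \<Longrightarrow> x \<in> W k"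
proof (induction k)
  case 0
  then show ?case using decomp by (simp add: W_def tensor_decomposition_def)
next
  case (Suc k)
  then show ?case using proj_W[of k x] by simp
qed

lemma commuting_iff_elem: "(\<forall>i<n. v i * x = x * v i) \<longleftrightarrow> x \<in> range (\<lambda>c. elem c n)"
proof
  assume "\<forall>i<n. v i * x = x * v i"
  then have "x \<in> W n" by (intro commuting_in_W) auto
  moreover have "W n \<subseteq> range (\<lambda>c. elem c n)"
    unfolding W_def by (intro span_minimal subspace_pfister_elem) (auto intro!: ord_prod_elem v_cent)
  ultimately show "x \<in> range (\<lambda>c. elem c n)" by blast
qed (auto simp: elem_v_commute)

sublocale dual_system smult \<sigma> n v u
proof
  fix s assume "\<And>i. i < n \<Longrightarrow> v i * s = s * v i"
  then obtain c where "s = elem c n" using commuting_iff_elem by blast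
  then show "\<sigma> s = s" "s * s \<in> scalars smult"
    by (auto simp: elem_inv elem_square scalars_def)
next
  fix i j assume "i < n" "j < n"
  then show "v i * u j + u j * v i = of_bool (i = j)"
    using vu Q_commute[of i j "v i" "u j"] v_in u_in by (cases "i = j") auto
qed (rule v_commute)

text \<open>\<open>C n\<close> consists of the \<open>elem c n\<close>; by independence these are
  nonzero exactly for nonzero coordinates, and their squares are the Pfister values.\<close>

lemma D_inv_eq_D_pfister: "D_inv smult \<sigma> = D_pfister n \<alpha>"
proof -
  have one: "(1::'a) \<noteq> 0"
    using orth AltI[of 0 UNIV] by (auto simp: orthogonal_char2_def)
  have "elem c n \<noteq> 0 \<longleftrightarrow> (\<exists>I\<in>Pow {..<n}. c I \<noteq> 0)" for c
    using elem_independent[of n c] pfister_elem_cong[of n c "\<lambda>I. 0" v] pfister_elem_0[of v n]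
    by auto
  moreover have "C n = range (\<lambda>c. elem c n)"
    using commuting_iff_elem C_n_iff by blast
  ultimately show ?thesis
    unfolding D_inv_eq_squares[OF orth] D_pfister_def
    using one by (auto simp: elem_square)
qed

end

theorem theorem4p10:
  fixes smult :: "'f::field \<Rightarrow> 'a::ring_1 \<Rightarrow> 'a"
    and \<sigma> :: "'a \<Rightarrow> 'a"
  assumes char2: "CHAR('f) = 2"
    and alg: "is_F_algebra smult"
    and findim: "fin_dim smult"
    and csa: "central_simple_on smult UNIV"
    and inv: "involution_first_kind smult \<sigma>"
    and orth: "orthogonal_char2 \<sigma>"
    and td: "totally_decomposable smult \<sigma>"
  shows "\<forall>n Q \<alpha> S. tensor_decomposition smult \<sigma> n Q \<and>
            (\<forall>i<n. represents_disc smult \<sigma> (Q i) (\<alpha> i)) \<and>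
            inseparable_subalgebra smult \<sigma> S \<longrightarrow>
          D_inv smult \<sigma> = D_pfister n \<alpha> \<and>
          D_pfister n \<alpha> = {c. \<exists>x\<in>S. x \<noteq> 0 \<and> x * x = smult c 1}"
proof (intro allI impI, elim conjE)
  fix n Q \<alpha> S
  assume dec: "tensor_decomposition smult \<sigma> n Q"
    and disc: "\<forall>i<n. represents_disc smult \<sigma> (Q i) (\<alpha> i)"
    and S: "inseparable_subalgebra smult \<sigma> S"
  interpret vector_space smult
    using alg by (simp add: is_F_algebra_def)
  obtain B where "finite B" "span B = UNIV"
    using findim by (auto simp: fin_dim_def)
  then obtain B' where B': "finite B'" "independent B'" "span B' = UNIV"
    using maximal_independent_subset[of B]
    by (metis finite_subset span_minimal subspace_span top.extremum_uniqueI)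
  interpret fin_dim_involution smult \<sigma> B'
  proof
    show "smult c x * y = smult c (x * y)" "x * smult c y = smult c (x * y)" for c x y
      using alg unfolding is_F_algebra_def by metis+
  qed (use B' char2 inv in auto)
  \<comment> \<open>Each restriction of \<sigma> inherits orthogonality, since its alternating
    elements are alternating in the whole algebra.\<close>
  have "1 \<notin> Alt \<sigma> (Q i)" for i
    using orth by (auto simp: orthogonal_char2_def Alt_def)
  then have "\<exists>v\<in>Q i. \<exists>u\<in>Q i. \<sigma> v = v \<and> v * v = smult (\<alpha> i) 1 \<and> v * u + u * v = 1 \<and>
    (\<forall>z\<in>Q i. v * z = z * v \<longrightarrow> (\<exists>c d. z = smult c 1 + smult d v))" if "i < n" for i
    using dec disc that
    by (intro represents_disc_generators) (auto simp: tensor_decomposition_def)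
  then obtain v u where vu: "\<And>i. i < n \<Longrightarrow> v i \<in> Q i \<and> u i \<in> Q i \<and> \<sigma> (v i) = v i \<and>
    v i * v i = smult (\<alpha> i) 1 \<and> v i * u i + u i * v i = 1 \<and>
    (\<forall>z\<in>Q i. v i * z = z * v i \<longrightarrow> (\<exists>c d. z = smult c 1 + smult d (v i)))"
    by metis
  interpret pfister_generators smult \<sigma> B' n Q u v \<alpha>
    by unfold_locales (use dec vu orth in auto)
  show "D_inv smult \<sigma> = D_pfister n \<alpha> \<and> D_pfister n \<alpha> = {c. \<exists>x\<in>S. x \<noteq> 0 \<and> x * x = smult c 1}"
    using D_inv_eq_D_pfister D_inv_inseparable[OF S orth] by simp
qed

end
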